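(* For each integer $n\ge 0$, let $RR_2(n)$ denote the number of partitions of $n$ into parts greater than $1$ in which the difference between any two parts is at least $2$, and let $\overline{RR_2}(n)$ denote the number of overpartitions of $n$ in which the non-overlined parts are even and distinct, and every overlined part is at most the number of non-overlined parts. Then $RR_2(n)=\overline{RR_2}(n)$ for every $n\ge 0$.
   Context: A partition of $n$ is a weakly decreasing finite sequence of positive integers (its parts) with sum $n$; parts at different positions count as different parts, so "difference at least $2$" excludes repeated parts. An overpartition of $n$ is a weakly decreasing finite sequence of positive integers with sum $n$ in which the last occurrence of a part of each given magnitude may or may not be overlined. Thus the overlined parts are automatically distinct from one another. "The non-overlined parts are distinct" means that they are pairwise distinct among themselves; an overlined and a non-overlined part may have the same magnitude. Conditions on parts of a given kind are vacuous if there are no such parts. There is exactly one partition and one overpartition of $0$ (the empty one). *)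

theory Defs
  imports Main
begin

definition is_partition :: "nat \<Rightarrow> nat list \<Rightarrow> bool" where
  "is_partition n xs \<longleftrightarrow>
     sorted_wrt (\<ge>) xs \<and> (\<forall>x\<in>set xs. 0 < x) \<and> sum_list xs = n"

text \<open>An overpartition is a list of pairs (magnitude, overlined?).  Only the last
  occurrence of each magnitude may carry an overline.\<close>

definition is_overpartition :: "nat \<Rightarrow> (nat \<times> bool) list \<Rightarrow> bool" where
  "is_overpartition n ps \<longleftrightarrow>
     is_partition n (map fst ps) \<and>
     (\<forall>i<length ps. snd (ps ! i) \<longrightarrow>
        (\<forall>j<length ps. i < j \<longrightarrow> fst (ps ! j) \<noteq> fst (ps ! i)))"

definition overlined_parts :: "(nat \<times> bool) list \<Rightarrow> nat list" where
  "overlined_parts ps = map fst (filter snd ps)"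

definition nonoverlined_parts :: "(nat \<times> bool) list \<Rightarrow> nat list" where
  "nonoverlined_parts ps = map fst (filter (\<lambda>p. \<not> snd p) ps)"

definition RR2_partitions :: "nat \<Rightarrow> nat list set" where
  "RR2_partitions n = {xs. is_partition n xs \<and> (\<forall>x\<in>set xs. 1 < x) \<and>
     (\<forall>i<length xs. \<forall>j<length xs. i \<noteq> j \<longrightarrow> 2 \<le> \<bar>int (xs ! i) - int (xs ! j)\<bar>)}"

definition RR2_overpartitions :: "nat \<Rightarrow> (nat \<times> bool) list set" where
  "RR2_overpartitions n = {ps. is_overpartition n ps \<and>
     (\<forall>x\<in>set (nonoverlined_parts ps). even x) \<and> distinct (nonoverlined_parts ps) \<and>
     (\<forall>x\<in>set (overlined_parts ps). x \<le> length (nonoverlined_parts ps))}"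

definition RR2 :: "nat \<Rightarrow> nat" where
  "RR2 n = card (RR2_partitions n)"

definition RR2_bar :: "nat \<Rightarrow> nat" where
  "RR2_bar n = card (RR2_overpartitions n)"

text \<open>Both counted sets are finite, so the cardinalities above are the intended counts.\<close>

lemma is_partition_bounds:
  assumes "is_partition n xs"
  shows "set xs \<subseteq> {..n}" and "length xs \<le> n"
proof -
  have s: "sum_list xs = n" and p: "\<forall>x\<in>set xs. 0 < x"
    using assms by (auto simp: is_partition_def)
  show "set xs \<subseteq> {..n}" using s member_le_sum_list by fastforce
  have "length ys \<le> sum_list ys" if "\<forall>x\<in>set ys. 0 < x" for ys :: "nat list"
    using that by (induction ys) auto
  then show "length xs \<le> n" using s p by blast
qed

lemma finite_RR2_partitions: "finite (RR2_partitions n)"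
proof (rule finite_subset)
  show "RR2_partitions n \<subseteq> {xs. set xs \<subseteq> {..n} \<and> length xs \<le> n}"
    using is_partition_bounds by (auto simp: RR2_partitions_def)
  show "finite {xs. set xs \<subseteq> {..n} \<and> length xs \<le> n}"
    by (rule finite_lists_length_le) simp
qed

lemma finite_RR2_overpartitions: "finite (RR2_overpartitions n)"
proof (rule finite_subset)
  show "RR2_overpartitions n \<subseteq> {ps. set ps \<subseteq> {..n} \<times> UNIV \<and> length ps \<le> n}"
  proof
    fix ps assume "ps \<in> RR2_overpartitions n"
    then have "is_partition n (map fst ps)"
      by (auto simp: RR2_overpartitions_def is_overpartition_def)
    from is_partition_bounds[OF this]
    show "ps \<in> {ps. set ps \<subseteq> {..n} \<times> UNIV \<and> length ps \<le> n}" by fastforce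
  qed
  show "finite {ps. set ps \<subseteq> {..n} \<times> (UNIV :: bool set) \<and> length ps \<le> n}"
    by (rule finite_lists_length_le) simp
qed

end

theory Submission
  imports Defs
begin

text \<open>
  An overpartition counted by \<open>RR2_bar\<close> amounts to a pair \<open>(E, U)\<close>, where \<open>E\<close> is the set of
  its non-overlined parts, \<open>k\<close> distinct positive even numbers, and \<open>U \<subseteq> {1..k}\<close> is the set of
  its overlined parts.  Let \<open>e\<^sub>1 > \<dots> > e\<^sub>k\<close> be the elements of \<open>E\<close>.  Adding the conjugate of
  the partition \<open>U\<close> to \<open>E\<close> part by part gives the numbers
  \<open>l\<^sub>i = e\<^sub>i + card {j \<in> U. i \<le> j}\<close>, which have the same total.  The gaps of the \<open>e\<^sub>i\<close> are at
  least 2 and the added numbers decrease weakly, so the \<open>l\<^sub>i\<close> form a partition into parts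
  greater than 1 with differences at least 2.

  Conversely, put \<open>l\<^bsub>k+1\<^esub> = 0\<close>.  Since the \<open>e\<^sub>i\<close> are even, \<open>i \<in> U\<close> holds exactly when
  \<open>l\<^sub>i - l\<^bsub>i+1\<^esub>\<close> is odd, so the \<open>l\<^sub>i\<close> determine \<open>U\<close> and then \<open>E\<close>.  Starting from
  arbitrary \<open>l\<^sub>i\<close> with gaps at least 2, this recipe gives even \<open>e\<^sub>i\<close> with
  \<open>e\<^sub>i - e\<^bsub>i+1\<^esub> \<ge> 1\<close>, hence with gaps at least 2 by parity.

  To make both directions simple list recursions, a pair \<open>(E, U)\<close> is written as the
  decreasing list of the \<open>e\<^sub>i\<close> in which \<open>e\<^sub>i\<close> carries a mark if \<open>i \<in> U\<close>.  The lemma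
  \<open>bij_betw_add_marks\<close> is the correspondence between marked lists and partitions; the lemmas
  \<open>bij_betw_marked_lists_set_pairs\<close> and \<open>bij_betw_overpartitions_set_pairs\<close> identify marked
  lists and overpartitions with pairs of sets.
\<close>

section \<open>Adding the conjugate of a set of marked positions\<close>

text \<open>Positions are counted from 1, since a mark at position \<open>i\<close> stands for an overlined
  part of size \<open>i\<close>.\<close>

definition marked_positions :: "(nat \<times> bool) list \<Rightarrow> nat set" where
  "marked_positions r = {Suc i |i. i < length r \<and> snd (r ! i)}"

fun add_marks :: "(nat \<times> bool) list \<Rightarrow> nat list" where
  "add_marks [] = []"
| "add_marks ((e, b) # r) = (e + of_bool b + card (marked_positions r)) # add_marks r"

definition even_decreasing :: "nat list \<Rightarrow> bool" where
  "even_decreasing es \<longleftrightarrow> sorted_wrt (>) es \<and> (\<forall>e\<in>set es. 0 < e \<and> even e)"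

definition even_marked_lists :: "nat \<Rightarrow> (nat \<times> bool) list set" where
  "even_marked_lists n =
     {r. even_decreasing (map fst r) \<and> sum_list (map fst r) + \<Sum>(marked_positions r) = n}"

lemma marked_positions_Nil [simp]: "marked_positions [] = {}"
  by (simp add: marked_positions_def)

lemma marked_positions_Cons:
  "marked_positions ((e, b) # r) = (if b then {1} else {}) \<union> Suc ` marked_positions r"
proof (rule set_eqI)
  fix m
  show "m \<in> marked_positions ((e, b) # r) \<longleftrightarrow>
        m \<in> (if b then {1} else {}) \<union> Suc ` marked_positions r"
    by (auto simp: marked_positions_def less_Suc_eq_0_disj image_iff split: if_splits)
qed

lemma finite_marked_positions [simp]: "finite (marked_positions r)"
  by (simp add: marked_positions_def)

lemma one_notin_Suc_marked: "1 \<notin> Suc ` marked_positions r"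
  by (auto simp: marked_positions_def)

lemma card_marked_positions_Cons:
  "card (marked_positions ((e, b) # r)) = of_bool b + card (marked_positions r)"
  using one_notin_Suc_marked by (simp add: marked_positions_Cons card_image)

lemma sum_marked_positions_Cons:
  "\<Sum>(marked_positions ((e, b) # r)) =
     of_bool b + card (marked_positions r) + \<Sum>(marked_positions r)"
proof -
  have "\<Sum>(Suc ` marked_positions r) = card (marked_positions r) + \<Sum>(marked_positions r)"
    by (simp add: sum.reindex sum_Suc)
  then show ?thesis
    using one_notin_Suc_marked by (simp add: marked_positions_Cons)
qed

text \<open>The mark at position \<open>i\<close> contributes 1 to each of the first \<open>i\<close> entries.\<close>

lemma sum_list_add_marks:
  "sum_list (add_marks r) = sum_list (map fst r) + \<Sum>(marked_positions r)"
  by (induction r rule: add_marks.induct) (auto simp: sum_marked_positions_Cons)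

lemma add_marks_eq_Nil_iff [simp]: "add_marks r = [] \<longleftrightarrow> r = []"
  by (cases r rule: add_marks.cases) auto

definition gapped :: "nat list \<Rightarrow> bool" where
  "gapped xs \<longleftrightarrow> sorted_wrt (\<lambda>x y. y + 2 \<le> x) xs \<and> (\<forall>x\<in>set xs. 2 \<le> x)"

text \<open>The last part is compared with a fictitious part 0; this puts the condition that all
  parts exceed 1 on the same footing as the gap condition.\<close>

lemma gapped_Cons:
  "gapped (x # xs) \<longleftrightarrow> (if xs = [] then 0 else hd xs) + 2 \<le> x \<and> gapped xs"
  by (cases xs) (auto simp: gapped_def)

lemma decreasing_positive_Cons:
  fixes e :: nat
  shows "sorted_wrt (>) (e # es) \<and> (\<forall>x\<in>set (e # es). 0 < x) \<longleftrightarrow>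
    (if es = [] then 0 else hd es) < e \<and> sorted_wrt (>) es \<and> (\<forall>x\<in>set es. 0 < x)"
  by (cases es) auto

lemma even_decreasing_Cons:
  "even_decreasing (e # es) \<longleftrightarrow>
     (if es = [] then 0 else hd es) < e \<and> even e \<and> even_decreasing es"
  using decreasing_positive_Cons[of e es] unfolding even_decreasing_def by auto

text \<open>The first entry grows by the number of all marks.  Hence the next entry put in front
  grows by that same amount, plus its own mark, and the gap between the two never shrinks.\<close>

lemma hd_add_marks:
  "(if add_marks r = [] then 0 else hd (add_marks r)) =
     (if map fst r = [] then 0 else hd (map fst r)) + card (marked_positions r)"
  by (cases r rule: add_marks.cases) (auto simp: card_marked_positions_Cons)

lemma even_decreasing_even_hd:
  "even_decreasing es \<Longrightarrow> even (if es = [] then 0 else hd es)"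
  by (cases es) (auto simp: even_decreasing_def)

lemma even_less_imp_add_2_le: "even m \<Longrightarrow> even n \<Longrightarrow> m < n \<Longrightarrow> m + 2 \<le> (n :: nat)"
  by presburger

lemma gapped_add_marks: "even_decreasing (map fst r) \<Longrightarrow> gapped (add_marks r)"
proof (induction r rule: add_marks.induct)
  case 1
  then show ?case by (simp add: gapped_def)
next
  case (2 e b r)
  let ?h = "if map fst r = [] then 0 else hd (map fst r)"
  from 2 have *: "?h < e" "even e" "even_decreasing (map fst r)"
    by (auto simp: even_decreasing_Cons)
  then have "even ?h" using even_decreasing_even_hd by blast
  with * have "?h + 2 \<le> e" by (intro even_less_imp_add_2_le)
  then show ?case
    using 2 * hd_add_marks[of r] by (simp add: gapped_Cons)
qed

text \<open>The original entries being even, the parity of an entry of the sum shows whether its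
  position is marked, once the marks further right are known.\<close>

lemma inj_on_add_marks: "inj_on add_marks {r. even_decreasing (map fst r)}"
proof -
  have "r = s" if "add_marks r = add_marks s" "even_decreasing (map fst r)"
    "even_decreasing (map fst s)" for r s
    using that
  proof (induction r arbitrary: s rule: add_marks.induct)
    case 1
    then show ?case by (metis add_marks.simps(1) add_marks_eq_Nil_iff)
  next
    case (2 e b r)
    then obtain e' b' s' where s: "s = (e', b') # s'"
      by (cases s rule: add_marks.cases) auto
    have rs: "r = s'"
      using 2 s by (auto simp: even_decreasing_Cons)
    then have eq: "e + of_bool b = e' + of_bool b'" and "even e" "even e'"
      using 2 s by (auto simp: even_decreasing_Cons)
    from eq have "even (e + of_bool b) = even (e' + of_bool b')" by simp
    with \<open>even e\<close> \<open>even e'\<close> have "b = b'" by (cases b; cases b') simp_all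
    with eq rs s show ?case by simp
  qed
  then show ?thesis by (auto simp: inj_on_def)
qed

text \<open>Working from the right, the marks already chosen account for a known part of each entry.
  The rest exceeds the previous even entry by at least 2, so lowering it by 1 where needed to
  make it even keeps the entries strictly decreasing.\<close>

lemma add_marks_surj:
  "gapped xs \<Longrightarrow> \<exists>r. even_decreasing (map fst r) \<and> add_marks r = xs"
proof (induction xs)
  case Nil
  then show ?case by (intro exI[of _ "[]"]) (simp add: even_decreasing_def)
next
  case (Cons x xs)
  then obtain r where r: "even_decreasing (map fst r)" "add_marks r = xs"
    by (auto simp: gapped_Cons)
  let ?c = "card (marked_positions r)"
  let ?h = "if map fst r = [] then 0 else hd (map fst r)"
  have le: "?h + ?c + 2 \<le> x"
    using Cons.prems unfolding gapped_Cons hd_add_marks[of r, unfolded r(2)] by simp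
  \<comment> \<open>The mark makes up for the parity of \<open>x - c\<close>.\<close>
  define b where "b = odd (x - ?c)"
  define e where "e = x - ?c - of_bool b"
  have "even e" "?h < e" "e + of_bool b + ?c = x"
    using le by (auto simp: e_def b_def)
  then have "even_decreasing (map fst ((e, b) # r))" "add_marks ((e, b) # r) = x # xs"
    using r by (auto simp: even_decreasing_Cons)
  then show ?case by blast
qed

lemma RR2_partitions_eq: "RR2_partitions n = {xs. gapped xs \<and> sum_list xs = n}"
proof (rule set_eqI)
  fix xs
  have "sorted_wrt (\<ge>) xs \<and>
      (\<forall>i<length xs. \<forall>j<length xs. i \<noteq> j \<longrightarrow> 2 \<le> \<bar>int (xs ! i) - int (xs ! j)\<bar>)
    \<longleftrightarrow> sorted_wrt (\<lambda>x y. y + 2 \<le> x) xs" (is "?L \<longleftrightarrow> ?R")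
  proof
    assume L: ?L
    show ?R
      unfolding sorted_wrt_iff_nth_less
    proof (intro allI impI)
      fix i j assume ij: "i < j" "j < length xs"
      then have "xs ! j \<le> xs ! i" using L by (auto simp: sorted_wrt_iff_nth_less)
      moreover have "2 \<le> \<bar>int (xs ! i) - int (xs ! j)\<bar>" using L ij by auto
      ultimately show "xs ! j + 2 \<le> xs ! i" by linarith
    qed
  next
    assume R: ?R
    have "2 \<le> \<bar>int (xs ! i) - int (xs ! j)\<bar>"
      if "i < length xs" "j < length xs" "i \<noteq> j" for i j
    proof -
      have "xs ! j + 2 \<le> xs ! i \<or> xs ! i + 2 \<le> xs ! j"
        using R that by (metis linorder_neqE_nat sorted_wrt_iff_nth_less)
      then show ?thesis by linarith
    qed
    moreover have "sorted_wrt (\<ge>) xs"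
      using R by (rule sorted_wrt_mono_rel[rotated]) simp
    ultimately show ?L by blast
  qed
  then show "xs \<in> RR2_partitions n \<longleftrightarrow> xs \<in> {xs. gapped xs \<and> sum_list xs = n}"
    unfolding RR2_partitions_def is_partition_def gapped_def by force
qed

lemma bij_betw_add_marks: "bij_betw add_marks (even_marked_lists n) (RR2_partitions n)"
proof -
  have eq: "even_marked_lists n =
      {r. even_decreasing (map fst r) \<and> sum_list (add_marks r) = n}"
    by (simp add: even_marked_lists_def sum_list_add_marks)
  have "inj_on add_marks (even_marked_lists n)"
    by (rule inj_on_subset[OF inj_on_add_marks]) (auto simp: eq)
  moreover have "add_marks ` even_marked_lists n = RR2_partitions n"
    using gapped_add_marks add_marks_surj by (fastforce simp: eq RR2_partitions_eq)
  ultimately show ?thesis by (simp add: bij_betw_def)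
qed

section \<open>Marked lists as pairs of sets\<close>

definition set_pairs :: "nat \<Rightarrow> (nat set \<times> nat set) set" where
  "set_pairs n = {(E, U). finite E \<and> (\<forall>e\<in>E. 0 < e \<and> even e) \<and> U \<subseteq> {1..card E} \<and>
     \<Sum>E + \<Sum>U = n}"

lemma decreasing_list_unique:
  fixes xs ys :: "nat list"
  assumes "sorted_wrt (>) xs" "sorted_wrt (>) ys" "set xs = set ys"
  shows "xs = ys"
proof -
  have "rev xs = rev ys"
    using assms by (intro strict_sorted_equal) (simp_all add: sorted_wrt_rev)
  then show ?thesis by simp
qed

lemma decreasing_list_distinct: "sorted_wrt (>) (xs :: nat list) \<Longrightarrow> distinct xs"
  by (induction xs) auto

lemma ex_decreasing_list:
  assumes "finite (S :: nat set)"
  shows "\<exists>xs. sorted_wrt (>) xs \<and> set xs = S"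
  using assms by (intro exI[of _ "rev (sorted_list_of_set S)"]) (simp add: sorted_wrt_rev)

lemma bij_betw_marked_lists_set_pairs:
  "bij_betw (\<lambda>r. (set (map fst r), marked_positions r)) (even_marked_lists n) (set_pairs n)"
  unfolding bij_betw_def
proof
  show "inj_on (\<lambda>r. (set (map fst r), marked_positions r)) (even_marked_lists n)"
  proof (rule inj_onI)
    fix r s
    assume r: "r \<in> even_marked_lists n" and s: "s \<in> even_marked_lists n"
      and "(set (map fst r), marked_positions r) = (set (map fst s), marked_positions s)"
    then have eq: "set (map fst r) = set (map fst s)" "marked_positions r = marked_positions s"
      by auto
    have fst: "map fst r = map fst s"
      using r s eq(1) by (intro decreasing_list_unique)
        (auto simp: even_marked_lists_def even_decreasing_def)
    then have len: "length r = length s" by (metis length_map)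
    have "snd (r ! i) = snd (s ! i)" if "i < length r" for i
    proof -
      have "snd (r ! i) \<longleftrightarrow> Suc i \<in> marked_positions r"
        using that by (simp add: marked_positions_def)
      also have "\<dots> \<longleftrightarrow> snd (s ! i)"
        using that len unfolding eq(2) by (simp add: marked_positions_def)
      finally show ?thesis .
    qed
    moreover have "fst (r ! i) = fst (s ! i)" if "i < length r" for i
      using fst that len by (metis nth_map)
    ultimately show "r = s"
      using len by (intro nth_equalityI prod_eqI) auto
  qed
next
  show "(\<lambda>r. (set (map fst r), marked_positions r)) ` even_marked_lists n = set_pairs n"
  proof (intro equalityI subsetI)
    fix p assume "p \<in> (\<lambda>r. (set (map fst r), marked_positions r)) ` even_marked_lists n"
    then obtain r where r: "r \<in> even_marked_lists n"
      and p: "p = (set (map fst r), marked_positions r)" by blast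
    have d: "distinct (map fst r)"
      using r by (intro decreasing_list_distinct)
        (simp add: even_marked_lists_def even_decreasing_def)
    have "card (set (map fst r)) = length r"
      using distinct_card[OF d] by simp
    moreover have "marked_positions r \<subseteq> {1..length r}"
      by (auto simp: marked_positions_def)
    moreover have "\<Sum>(set (map fst r)) = sum_list (map fst r)"
      using distinct_sum_list_conv_Sum[OF d] by simp
    ultimately show "p \<in> set_pairs n"
      using r by (simp add: p set_pairs_def even_marked_lists_def even_decreasing_def)
  next
    fix p assume "p \<in> set_pairs n"
    then obtain E U where p: "p = (E, U)" and fin: "finite E"
      and E: "\<forall>e\<in>E. 0 < e \<and> even e" and U: "U \<subseteq> {1..card E}" and sum: "\<Sum>E + \<Sum>U = n"
      by (auto simp: set_pairs_def)
    from ex_decreasing_list[OF fin] obtain es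
      where es: "sorted_wrt (>) es" "set es = E" by blast
    then have d: "distinct es" by (simp add: decreasing_list_distinct)
    have len: "length es = card E"
      using distinct_card[OF d] es by simp
    define r where "r = zip es (map (\<lambda>i. Suc i \<in> U) [0..<length es])"
    have fst: "map fst r = es" by (simp add: r_def)
    have "marked_positions r = {Suc i |i. i < length es \<and> Suc i \<in> U}"
      by (auto simp: marked_positions_def r_def)
    also have "\<dots> = U"
    proof (intro equalityI subsetI)
      fix u assume "u \<in> U"
      then have "0 < u" "u \<le> length es" using U len by auto
      with \<open>u \<in> U\<close> show "u \<in> {Suc i |i. i < length es \<and> Suc i \<in> U}"
        by (auto simp: gr0_conv_Suc)
    qed auto
    finally have pos: "marked_positions r = U" .
    have "sum_list es = \<Sum>E"
      using distinct_sum_list_conv_Sum[OF d] es by simp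
    then have "r \<in> even_marked_lists n"
      unfolding even_marked_lists_def even_decreasing_def mem_Collect_eq fst pos
      using es E sum by simp
    moreover have "p = (set (map fst r), marked_positions r)"
      unfolding fst by (simp add: p pos es)
    ultimately show "p \<in> (\<lambda>r. (set (map fst r), marked_positions r)) ` even_marked_lists n"
      by blast
  qed
qed

section \<open>Overpartitions as pairs of sets\<close>

text \<open>Among parts of equal magnitude the overlined one comes last.  Encoding it by an even
  number and its non-overlined twin by the next odd number turns the order in which an
  overpartition is written into the decreasing order of the natural numbers.\<close>

definition key :: "nat \<times> bool \<Rightarrow> nat" where
  "key p = 2 * fst p + of_bool (\<not> snd p)"

lemma inj_key: "inj key"
proof (rule injI)
  fix p q assume "key p = key q"
  then show "p = q"
    by (cases p; cases q; cases "snd p"; cases "snd q") (auto simp: key_def, presburger+)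
qed

lemma surj_key: "surj key"
proof (rule surjI)
  show "key (m div 2, even m) = m" for m by (simp add: key_def)
qed

text \<open>If the non-overlined parts are distinct, no part is repeated with the same overlining,
  so the keys decrease strictly.\<close>

lemma overpartition_iff_keys_decreasing:
  "is_overpartition n ps \<and> distinct (nonoverlined_parts ps) \<longleftrightarrow>
     sorted_wrt (>) (map key ps) \<and> (\<forall>p\<in>set ps. 0 < fst p) \<and> sum_list (map fst ps) = n"
proof -
  have dist: "distinct (nonoverlined_parts ps) \<longleftrightarrow>
      sorted_wrt (\<lambda>p q. \<not> snd p \<longrightarrow> \<not> snd q \<longrightarrow> fst p \<noteq> fst q) ps" (is "_ \<longleftrightarrow> sorted_wrt ?D ps")
    by (induction ps) (auto simp: nonoverlined_parts_def)
  have last: "(\<forall>i<length ps. snd (ps ! i) \<longrightarrow>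
        (\<forall>j<length ps. i < j \<longrightarrow> fst (ps ! j) \<noteq> fst (ps ! i))) \<longleftrightarrow>
      sorted_wrt (\<lambda>p q. snd p \<longrightarrow> fst q \<noteq> fst p) ps" (is "_ \<longleftrightarrow> sorted_wrt ?L ps")
    by (auto simp: sorted_wrt_iff_nth_less)
  have pointwise: "key q < key p \<longleftrightarrow> fst q \<le> fst p \<and> ?L p q \<and> ?D p q" for p q
    by (cases "snd p"; cases "snd q") (auto simp: key_def)
  have "sorted_wrt (>) (map key ps) \<longleftrightarrow>
      sorted_wrt (\<ge>) (map fst ps) \<and> sorted_wrt ?L ps \<and> sorted_wrt ?D ps"
    unfolding sorted_wrt_map pointwise by (auto simp: sorted_wrt_iff_nth_less)
  then show ?thesis
    unfolding is_overpartition_def is_partition_def dist last by auto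
qed

lemma set_nonoverlined_parts: "set (nonoverlined_parts ps) = {x. (x, False) \<in> set ps}"
  by (force simp: nonoverlined_parts_def)

lemma set_overlined_parts: "set (overlined_parts ps) = {x. (x, True) \<in> set ps}"
  by (force simp: overlined_parts_def)

lemma sum_list_parts:
  "sum_list (map fst ps) = sum_list (nonoverlined_parts ps) + sum_list (overlined_parts ps)"
  by (induction ps) (auto simp: nonoverlined_parts_def overlined_parts_def)

lemma set_pairs_iff_overpartition:
  assumes "sorted_wrt (>) (map key ps)"
  shows "(set (nonoverlined_parts ps), set (overlined_parts ps)) \<in> set_pairs n \<longleftrightarrow>
    ps \<in> RR2_overpartitions n"
proof -
  have d: "distinct (map key ps)" using assms by (rule decreasing_list_distinct)
  then have "distinct ps" by (simp add: distinct_map)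
  then have dn: "distinct (nonoverlined_parts ps)" and dov: "distinct (overlined_parts ps)"
    by (auto simp: nonoverlined_parts_def overlined_parts_def distinct_map inj_on_def prod_eq_iff)
  have sums: "\<Sum>(set (nonoverlined_parts ps)) + \<Sum>(set (overlined_parts ps)) =
      sum_list (map fst ps)"
    using distinct_sum_list_conv_Sum[OF dn] distinct_sum_list_conv_Sum[OF dov]
    by (simp add: sum_list_parts)
  have pos: "(\<forall>p\<in>set ps. 0 < fst p) \<longleftrightarrow>
      (\<forall>x\<in>set (nonoverlined_parts ps). 0 < x) \<and> (\<forall>x\<in>set (overlined_parts ps). 0 < x)"
    unfolding set_nonoverlined_parts set_overlined_parts by (auto, metis (full_types))
  have "ps \<in> RR2_overpartitions n \<longleftrightarrow>
      (\<forall>p\<in>set ps. 0 < fst p) \<and> sum_list (map fst ps) = n \<and>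
      (\<forall>x\<in>set (nonoverlined_parts ps). even x) \<and>
      (\<forall>x\<in>set (overlined_parts ps). x \<le> length (nonoverlined_parts ps))"
    using overpartition_iff_keys_decreasing[of n ps] assms dn
    by (auto simp: RR2_overpartitions_def)
  then show ?thesis
    unfolding pos using distinct_card[OF dn] sums
    by (auto simp: set_pairs_def Suc_le_eq)
qed

lemma overpartition_keys_decreasing:
  "ps \<in> RR2_overpartitions n \<Longrightarrow> sorted_wrt (>) (map key ps)"
  using overpartition_iff_keys_decreasing[of n ps] by (auto simp: RR2_overpartitions_def)

lemma bij_betw_overpartitions_set_pairs:
  "bij_betw (\<lambda>ps. (set (nonoverlined_parts ps), set (overlined_parts ps)))
     (RR2_overpartitions n) (set_pairs n)"
  unfolding bij_betw_def
proof
  show "inj_on (\<lambda>ps. (set (nonoverlined_parts ps), set (overlined_parts ps)))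
      (RR2_overpartitions n)"
  proof (rule inj_onI)
    fix ps qs
    assume ps: "ps \<in> RR2_overpartitions n" and qs: "qs \<in> RR2_overpartitions n"
      and eq: "(set (nonoverlined_parts ps), set (overlined_parts ps)) =
        (set (nonoverlined_parts qs), set (overlined_parts qs))"
    have "p \<in> set ps \<longleftrightarrow> p \<in> set qs" for p
      using eq by (cases p; cases "snd p")
        (auto simp: set_nonoverlined_parts set_overlined_parts set_eq_iff)
    then have "set (map key ps) = set (map key qs)" by auto
    then have "map key ps = map key qs"
      using ps qs by (intro decreasing_list_unique overpartition_keys_decreasing)
    then show "ps = qs" using inj_key by (simp add: inj_map_eq_map)
  qed
next
  show "(\<lambda>ps. (set (nonoverlined_parts ps), set (overlined_parts ps))) ` RR2_overpartitions n
      = set_pairs n"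
  proof (intro equalityI subsetI)
    fix p assume "p \<in> set_pairs n"
    then obtain E U where p: "p = (E, U)" and mem: "(E, U) \<in> set_pairs n"
      by (cases p) auto
    have "finite E" "finite U"
      using mem finite_subset[of U "{1..card E}"] by (auto simp: set_pairs_def)
    then have "finite (key ` (E \<times> {False} \<union> U \<times> {True}))" by simp
    from ex_decreasing_list[OF this] obtain ks where ks: "sorted_wrt (>) ks"
      "set ks = key ` (E \<times> {False} \<union> U \<times> {True})" by blast
    define ps where "ps = map (inv key) ks"
    have map: "map key ps = ks"
      by (simp add: ps_def map_idI surj_f_inv_f[OF surj_key])
    have "set ps = inv key ` key ` (E \<times> {False} \<union> U \<times> {True})"
      by (simp add: ps_def ks)
    also have "\<dots> = E \<times> {False} \<union> U \<times> {True}"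
      by (simp only: image_inv_f_f[OF inj_key])
    finally have "set (nonoverlined_parts ps) = E" "set (overlined_parts ps) = U"
      by (auto simp: set_nonoverlined_parts set_overlined_parts)
    then show "p \<in> (\<lambda>ps. (set (nonoverlined_parts ps), set (overlined_parts ps))) `
        RR2_overpartitions n"
      using set_pairs_iff_overpartition[of ps n] ks mem by (auto simp: map p)
  qed (use set_pairs_iff_overpartition overpartition_keys_decreasing in blast)
qed

theorem theorem3p5:
  fixes n :: nat
  shows "RR2 n = RR2_bar n"
proof -
  have "card (RR2_partitions n) = card (even_marked_lists n)"
    using bij_betw_same_card[OF bij_betw_add_marks] by simp
  also have "\<dots> = card (set_pairs n)"
    by (rule bij_betw_same_card[OF bij_betw_marked_lists_set_pairs])
  also have "\<dots> = card (RR2_overpartitions n)"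
    using bij_betw_same_card[OF bij_betw_overpartitions_set_pairs] by simp
  finally show ?thesis by (simp add: RR2_def RR2_bar_def)
qed

end
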